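(* Let $G=(V,E)$ be a finite connected simple graph and let $2\le n\le |V|$. Consider the Markov chain on $\mathrm{Subtrees}(G,n)$ with the following transition: given $X_0=t$, pick two edges $\mathbf e_1,\mathbf e_2$ independently and uniformly in $E$, and set $X_1=\mathrm{Exchange}(t,\mathbf e_1,\mathbf e_2)$. This chain is aperiodic and irreducible and its transition matrix is symmetric; hence the uniform distribution on $\mathrm{Subtrees}(G,n)$ is its unique invariant distribution, and the chain is ergodic (its law converges to this distribution from any initial state).
   Context: $\mathrm{Subtrees}(G,n)$ denotes the set of subgraphs of $G$ which are trees with exactly $n$ vertices (for $n\ge 2$ such a tree is identified with its set of $n-1$ edges). For $t\in\mathrm{Subtrees}(G,n)$ and $e,e'\in E$, $\mathrm{Exchange}(t,e,e')\in \mathrm{Subtrees}(G,n)$ is defined as follows: if $(E(t)\cup\{e\})\setminus\{e'\}$ is the edge set of a tree with $n$ vertices, then $\mathrm{Exchange}(t,e,e')$ is that tree; otherwise $\mathrm{Exchange}(t,e,e')=t$. *)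

theory Defs
  imports "HOL-Probability.Probability"
begin

section \<open>Finite simple graphs, trees and subtrees\<close>

type_synonym 'a ugraph = "'a set \<times> 'a set set"

abbreviation verts :: "'a ugraph \<Rightarrow> 'a set" where "verts \<equiv> fst"
abbreviation edges :: "'a ugraph \<Rightarrow> 'a set set" where "edges \<equiv> snd"

definition simple_graph :: "'a ugraph \<Rightarrow> bool" where
  "simple_graph G \<longleftrightarrow> (\<forall>e\<in>edges G. e \<subseteq> verts G \<and> card e = 2)"

definition finite_simple_graph :: "'a ugraph \<Rightarrow> bool" where
  "finite_simple_graph G \<longleftrightarrow> simple_graph G \<and> finite (verts G)"

definition adjacency :: "'a ugraph \<Rightarrow> ('a \<times> 'a) set" where
  "adjacency G = {(u, v). {u, v} \<in> edges G}"

text \<open>Connected graphs are non-empty by convention.\<close>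

definition connected_graph :: "'a ugraph \<Rightarrow> bool" where
  "connected_graph G \<longleftrightarrow>
     verts G \<noteq> {} \<and> (\<forall>u\<in>verts G. \<forall>v\<in>verts G. (u, v) \<in> (adjacency G)\<^sup>*)"

text \<open>A cycle is given by the list of its vertices, without repetition of the first one.\<close>

definition is_cycle :: "'a ugraph \<Rightarrow> 'a list \<Rightarrow> bool" where
  "is_cycle G xs \<longleftrightarrow> length xs \<ge> 3 \<and> distinct xs \<and>
     (\<forall>i<length xs. {xs ! i, xs ! (Suc i mod length xs)} \<in> edges G)"

definition is_tree :: "'a ugraph \<Rightarrow> bool" where
  "is_tree T \<longleftrightarrow> simple_graph T \<and> connected_graph T \<and> (\<nexists>xs. is_cycle T xs)"

definition subgraph :: "'a ugraph \<Rightarrow> 'a ugraph \<Rightarrow> bool" where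
  "subgraph H G \<longleftrightarrow> simple_graph H \<and> verts H \<subseteq> verts G \<and> edges H \<subseteq> edges G"

definition Subtrees :: "'a ugraph \<Rightarrow> nat \<Rightarrow> 'a ugraph set" where
  "Subtrees G n = {t. subgraph t G \<and> is_tree t \<and> finite (verts t) \<and> card (verts t) = n}"

text \<open>For \<open>n \<ge> 2\<close> a tree in \<open>Subtrees G n\<close> is determined by its edge set, so that the
  definite description below denotes.\<close>

definition exchange :: "'a ugraph \<Rightarrow> nat \<Rightarrow> 'a ugraph \<Rightarrow> 'a set \<Rightarrow> 'a set \<Rightarrow> 'a ugraph" where
  "exchange G n t e e' =
     (let F = (edges t \<union> {e}) - {e'} in
      if \<exists>s\<in>Subtrees G n. edges s = F
      then (THE s. s \<in> Subtrees G n \<and> edges s = F)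
      else t)"

section \<open>Discrete-time Markov chains\<close>

text \<open>A chain on a state space \<open>S\<close> is given by its transition kernel \<open>K\<close>, where \<open>K s\<close> is the
  law of \<open>X\<^sub>1\<close> given \<open>X\<^sub>0 = s\<close>. Values of \<open>K\<close> outside \<open>S\<close> are irrelevant.\<close>

definition markov_kernel_on :: "'s set \<Rightarrow> ('s \<Rightarrow> 's pmf) \<Rightarrow> bool" where
  "markov_kernel_on S K \<longleftrightarrow> (\<forall>s\<in>S. set_pmf (K s) \<subseteq> S)"

primrec chain_law :: "('s \<Rightarrow> 's pmf) \<Rightarrow> 's pmf \<Rightarrow> nat \<Rightarrow> 's pmf" where
  "chain_law K \<mu> 0 = \<mu>"
| "chain_law K \<mu> (Suc k) = bind_pmf (chain_law K \<mu> k) K"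

abbreviation step_prob :: "('s \<Rightarrow> 's pmf) \<Rightarrow> nat \<Rightarrow> 's \<Rightarrow> 's \<Rightarrow> real" where
  "step_prob K k s t \<equiv> pmf (chain_law K (return_pmf s) k) t"

definition irreducible_on :: "'s set \<Rightarrow> ('s \<Rightarrow> 's pmf) \<Rightarrow> bool" where
  "irreducible_on S K \<longleftrightarrow> (\<forall>s\<in>S. \<forall>t\<in>S. \<exists>k. step_prob K k s t > 0)"

definition aperiodic_on :: "'s set \<Rightarrow> ('s \<Rightarrow> 's pmf) \<Rightarrow> bool" where
  "aperiodic_on S K \<longleftrightarrow> (\<forall>s\<in>S. Gcd {k. k > 0 \<and> step_prob K k s s > 0} = (1::nat))"

definition symmetric_on :: "'s set \<Rightarrow> ('s \<Rightarrow> 's pmf) \<Rightarrow> bool" where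
  "symmetric_on S K \<longleftrightarrow> (\<forall>s\<in>S. \<forall>t\<in>S. pmf (K s) t = pmf (K t) s)"

definition invariant_on :: "'s set \<Rightarrow> ('s \<Rightarrow> 's pmf) \<Rightarrow> 's pmf \<Rightarrow> bool" where
  "invariant_on S K \<mu> \<longleftrightarrow> set_pmf \<mu> \<subseteq> S \<and> bind_pmf \<mu> K = \<mu>"

text \<open>On a finite or countable state space, pointwise convergence of the probability mass
  functions to a probability mass function is convergence in law.\<close>

definition law_converges_on :: "'s set \<Rightarrow> ('s \<Rightarrow> 's pmf) \<Rightarrow> 's pmf \<Rightarrow> bool" where
  "law_converges_on S K \<mu> \<longleftrightarrow>
     (\<forall>s\<in>S. \<forall>t\<in>S. (\<lambda>k. step_prob K k s t) \<longlonglongrightarrow> pmf \<mu> t)"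

section \<open>The exchange chain\<close>

definition exchange_kernel :: "'a ugraph \<Rightarrow> nat \<Rightarrow> 'a ugraph \<Rightarrow> 'a ugraph pmf" where
  "exchange_kernel G n t =
     map_pmf (\<lambda>(e1, e2). exchange G n t e1 e2)
       (pair_pmf (pmf_of_set (edges G)) (pmf_of_set (edges G)))"

end

theory Submission
  imports Defs
begin

text \<open>
  The combinatorial content is that the exchange moves connect all subtrees of the same size.
  Everything rests on one growth principle (\<open>grown_extend\<close>): inside a connected graph \<open>H\<close>, a subtree
  \<open>C\<close> can be enlarged, one pendant vertex at a time, to a subtree of any size between \<open>|C|\<close> and
  \<open>|V(H)|\<close>. Apply it to \<open>H = t + uv\<close>, where \<open>t\<close> is a tree with \<open>n\<close> vertices and \<open>uv\<close> a new edge
  touching \<open>t\<close>, and to a subtree \<open>C\<close> of \<open>H\<close> that contains \<open>uv\<close> and has at most \<open>n\<close> vertices. The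
  resulting tree \<open>s\<close> has \<open>n - 1\<close> of the \<open>n\<close> edges of \<open>H\<close>, so it arises from \<open>t\<close> by one exchange,
  and it contains \<open>C\<close> (\<open>exchange_keeping\<close>). This covers at once the case in which \<open>uv\<close> adds a pendant
  vertex and another leaf is dropped, and the case in which \<open>uv\<close> closes a cycle that is broken
  elsewhere.

  Irreducibility follows in two stages. With \<open>C\<close> a single edge leaving the tree, exchanges move the
  tree along a path of \<open>G\<close> until it contains a vertex of the target
  (\<open>exchange_reaches_vertex\<close>). After that, with \<open>C\<close> a common subtree of the current tree and the
  target, enlarged by an edge of the target, exchanges make the common subtree grow until it is the
  whole target (\<open>exchange_reaches_from_common_subtree\<close>).

  A proper exchange swaps an edge outside \<open>t\<close> with an edge of \<open>t\<close>, and swapping the two edges back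
  undoes it, so exchanging the roles of the two random edges gives the symmetry of the kernel.
  Drawing the same edge of \<open>t\<close> twice leaves \<open>t\<close> unchanged, so every state has a positive
  holding probability; this gives aperiodicity.

  The rest holds for every finite symmetric irreducible chain with positive holding
  probabilities. Some power of the kernel has all entries at least \<open>\<delta> > 0\<close>, and such a
  kernel contracts the \<open>\<ell>\<^sup>1\<close> distance of laws by the factor \<open>1 - |S| \<delta>\<close>
  (Dobrushin's argument, \<open>l1_dist_contraction\<close>). So the law converges to an invariant law from
  every initial law, which also shows that the invariant law is unique; by symmetry, the uniform
  law is invariant.
\<close>

section \<open>Trees grown by pendant vertices\<close>

text \<open>An inductive description of finite trees. It makes the edge count and the absence of cycles
  routine inductions, and it provides subtrees of prescribed size.\<close>

inductive grown :: "'a ugraph \<Rightarrow> bool" where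
  single: "grown ({v}, {})"
| pendant: "grown (V, E) \<Longrightarrow> u \<in> V \<Longrightarrow> v \<notin> V \<Longrightarrow> grown (insert v V, insert {u, v} E)"

lemma simple_graph_edge_verts:
  "simple_graph H \<Longrightarrow> {u, v} \<in> edges H \<Longrightarrow> u \<in> verts H \<and> v \<in> verts H \<and> u \<noteq> v"
  unfolding simple_graph_def by fastforce

lemma subgraph_trans: "subgraph A B \<Longrightarrow> subgraph B C \<Longrightarrow> subgraph A C"
  unfolding subgraph_def by blast

lemma grown_basic:
  assumes "grown T"
  shows "simple_graph T \<and> finite (verts T) \<and> finite (edges T) \<and> verts T \<noteq> {} \<and>
    card (verts T) = Suc (card (edges T))"
  using assms
proof induction
  case (single v)
  then show ?case by (simp add: simple_graph_def)
next
  case (pendant V E u v)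
  then have "u \<noteq> v" and "{u, v} \<notin> E"
    by (auto simp: simple_graph_def)
  then show ?case
    using pendant by (auto simp: simple_graph_def)
qed

lemmas grown_simple = grown_basic[THEN conjunct1]
  and grown_finite_verts = grown_basic[THEN conjunct2, THEN conjunct1]
  and grown_finite_edges = grown_basic[THEN conjunct2, THEN conjunct2, THEN conjunct1]
  and grown_nonempty = grown_basic[THEN conjunct2, THEN conjunct2, THEN conjunct2, THEN conjunct1]
  and grown_card = grown_basic[THEN conjunct2, THEN conjunct2, THEN conjunct2, THEN conjunct2]

text \<open>A tree with an edge has no isolated vertex. This is why trees with at least two vertices may be
  identified with their edge sets.\<close>

lemma grown_verts_eq_Union_edges:
  "grown T \<Longrightarrow> edges T \<noteq> {} \<Longrightarrow> verts T = \<Union>(edges T)"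
proof (induction rule: grown.induct)
  case (single v)
  then show ?case by simp
next
  case (pendant V E u v)
  show ?case
  proof (cases "E = {}")
    case True
    then have "card V = 1" using grown_card[OF pendant.hyps(1)] by simp
    then have "V = {u}" using pendant.hyps(2) by (auto simp: card_1_singleton_iff)
    then show ?thesis using True by auto
  next
    case False
    then show ?thesis using pendant by auto
  qed
qed

lemma grown_path:
  assumes "grown T" "x \<in> verts T" "y \<in> verts T"
  shows "\<exists>xs. xs \<noteq> [] \<and> hd xs = x \<and> last xs = y \<and> distinct xs \<and> set xs \<subseteq> verts T \<and>
    successively (\<lambda>a b. {a, b} \<in> edges T) xs"
  using assms
proof (induction arbitrary: x y rule: grown.induct)
  case (single v)
  then show ?case by (intro exI[of _ "[v]"]) auto
next
  case (pendant V E u v)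
  have mono: "successively (\<lambda>a b. {a, b} \<in> insert {u, v} E) xs"
    if "successively (\<lambda>a b. {a, b} \<in> E) xs" for xs
    using that by (rule successively_mono) auto
  consider "x = v" "y = v" | "x = v" "y \<in> V" | "x \<in> V" "y = v" | "x \<in> V" "y \<in> V"
    using pendant.prems by auto
  then show ?case
  proof cases
    case 1
    then show ?thesis by (intro exI[of _ "[v]"]) auto
  next
    case 2
    obtain xs where xs: "xs \<noteq> []" "hd xs = u" "last xs = y" "distinct xs" "set xs \<subseteq> V"
      "successively (\<lambda>a b. {a, b} \<in> E) xs"
      using pendant.IH[of u y] pendant.hyps(2) 2 by auto
    show ?thesis
      using xs mono[OF xs(6)] 2 pendant.hyps(3)
      by (intro exI[of _ "v # xs"]) (auto simp: successively_Cons insert_commute)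
  next
    case 3
    obtain xs where xs: "xs \<noteq> []" "hd xs = x" "last xs = u" "distinct xs" "set xs \<subseteq> V"
      "successively (\<lambda>a b. {a, b} \<in> E) xs"
      using pendant.IH[of x u] pendant.hyps(2) 3 by auto
    show ?thesis
      using xs mono[OF xs(6)] 3 pendant.hyps(3)
      by (intro exI[of _ "xs @ [v]"]) (auto simp: successively_append_iff)
  next
    case 4
    obtain xs where xs: "xs \<noteq> []" "hd xs = x" "last xs = y" "distinct xs" "set xs \<subseteq> V"
      "successively (\<lambda>a b. {a, b} \<in> E) xs"
      using pendant.IH[of x y] 4 by auto
    show ?thesis
      using xs mono[OF xs(6)] by (intro exI[of _ xs]) auto
  qed
qed

lemma successively_rtrancl:
  "xs \<noteq> [] \<Longrightarrow> successively (\<lambda>a b. (a, b) \<in> R) xs \<Longrightarrow> (hd xs, last xs) \<in> R\<^sup>*"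
proof (induction xs)
  case (Cons a xs)
  then show ?case
    by (cases xs) (auto intro: converse_rtrancl_into_rtrancl)
qed simp

lemma grown_connected:
  assumes "grown T"
  shows "connected_graph T"
  unfolding connected_graph_def
proof (intro conjI ballI)
  show "verts T \<noteq> {}" by (rule grown_nonempty[OF assms])
next
  fix x y assume "x \<in> verts T" "y \<in> verts T"
  then obtain xs where xs: "xs \<noteq> []" "hd xs = x" "last xs = y"
    "successively (\<lambda>a b. {a, b} \<in> edges T) xs"
    using grown_path[OF assms] by blast
  then show "(x, y) \<in> (adjacency T)\<^sup>*"
    using successively_rtrancl[of xs "adjacency T"] by (simp add: adjacency_def)
qed

text \<open>A vertex on a cycle has two distinct neighbours there, whereas the vertex attached last has only
  one neighbour. Hence every cycle already lies in the smaller tree.\<close>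

lemma grown_acyclic: "grown T \<Longrightarrow> \<not> is_cycle T xs"
proof (induction rule: grown.induct)
  case (single v)
  have "{xs ! 0, xs ! (Suc 0 mod length xs)} \<in> {}" if "is_cycle ({v}, {}) xs"
    using that unfolding is_cycle_def by (metis gr0I not_numeral_le_zero snd_conv)
  then show ?case by blast
next
  case (pendant V E u v)
  let ?T = "(insert v V, insert {u, v} E)"
  let ?l = "length xs"
  show ?case
  proof
    assume cyc: "is_cycle ?T xs"
    then have l: "?l \<ge> 3" and d: "distinct xs"
      and e: "\<And>i. i < ?l \<Longrightarrow> {xs ! i, xs ! (Suc i mod ?l)} \<in> insert {u, v} E"
      by (auto simp: is_cycle_def)
    have vE: "v \<notin> f" if "f \<in> E" for f
      using grown_simple[OF pendant.hyps(1)] that pendant.hyps(3)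
      by (auto simp: simple_graph_def)
    have at_v: "w = u" if "{v, w} \<in> insert {u, v} E" for w
      using that vE[of "{v, w}"] by (auto simp: doubleton_eq_iff)
    have "v \<in> set xs"
    proof (rule ccontr)
      assume nv: "v \<notin> set xs"
      have "{xs ! i, xs ! (Suc i mod ?l)} \<in> E" if "i < ?l" for i
      proof -
        have "Suc i mod ?l < ?l" using l by (intro mod_less_divisor) auto
        then have "xs ! i \<noteq> v" "xs ! (Suc i mod ?l) \<noteq> v"
          using nv that by (auto simp: in_set_conv_nth)
        then show ?thesis using e[OF that] by (auto simp: doubleton_eq_iff)
      qed
      then have "is_cycle (V, E) xs" using l d by (simp add: is_cycle_def)
      then show False using pendant.IH by simp
    qed
    then obtain i where i: "i < ?l" "xs ! i = v" by (auto simp: in_set_conv_nth)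
    define p where "p = (if i = 0 then ?l - 1 else i - 1)"
    define q where "q = (if Suc i = ?l then 0 else Suc i)"
    have p: "p < ?l" "Suc p mod ?l = i" using i l by (auto simp: p_def)
    have q: "q < ?l" "Suc i mod ?l = q" using i l by (auto simp: q_def)
    have "p \<noteq> q" using i l by (auto simp: p_def q_def split: if_splits)
    moreover have "xs ! p = u"
      using e[OF p(1)] p(2) i(2) at_v[of "xs ! p"] by (simp add: insert_commute)
    moreover have "xs ! q = u"
      using e[OF i(1)] q(2) i(2) at_v[of "xs ! q"] by simp
    ultimately show False
      using d p(1) q(1) by (metis nth_eq_iff_index_eq)
  qed
qed

lemma connected_graph_cut:
  assumes "simple_graph H" "connected_graph H" "W \<subseteq> verts H" "W \<noteq> {}" "W \<noteq> verts H"
  shows "\<exists>u v. u \<in> W \<and> v \<notin> W \<and> v \<in> verts H \<and> {u, v} \<in> edges H"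
proof (rule ccontr)
  assume no: "\<not> ?thesis"
  obtain a b where ab: "a \<in> W" "b \<in> verts H" "b \<notin> W" using assms by blast
  then have "(a, b) \<in> (adjacency H)\<^sup>*"
    using assms unfolding connected_graph_def by blast
  then have "b \<in> W"
  proof induction
    case base
    then show ?case by (rule ab)
  next
    case (step y z)
    then show ?case
      using no simple_graph_edge_verts[OF assms(1)] by (auto simp: adjacency_def)
  qed
  then show False using ab by simp
qed

text \<open>As long as the tree does not span the connected graph, some edge of the graph leaves its vertex
  set, and the other end of that edge can be attached as a pendant vertex.\<close>

lemma grown_extend:
  assumes H: "simple_graph H" "connected_graph H" "finite (verts H)"
    and C: "grown C" "subgraph C H"
    and m: "card (verts C) \<le> m" "m \<le> card (verts H)"
  shows "\<exists>T. grown T \<and> subgraph C T \<and> subgraph T H \<and> card (verts T) = m"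
  using m
proof (induction m rule: dec_induct)
  case base
  then show ?case
    using C grown_simple[OF C(1)] by (intro exI[of _ C]) (auto simp: subgraph_def)
next
  case (step m)
  then obtain T where T: "grown T" "subgraph C T" "subgraph T H" "card (verts T) = m"
    by auto
  have "verts T \<noteq> verts H" using T(4) step.prems by auto
  then obtain u v where uv: "u \<in> verts T" "v \<notin> verts T" "v \<in> verts H" "{u, v} \<in> edges H"
    using connected_graph_cut[OF H(1,2)] T(3) grown_nonempty[OF T(1)]
    by (metis subgraph_def)
  let ?T = "(insert v (verts T), insert {u, v} (edges T))"
  have g: "grown ?T" using T(1) uv by (intro grown.pendant) auto
  moreover have "subgraph C ?T" "subgraph ?T H"
    using T uv grown_simple[OF g] by (auto simp: subgraph_def)
  moreover have "card (verts ?T) = Suc m"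
    using T(4) uv grown_finite_verts[OF T(1)] by simp
  ultimately show ?case by blast
qed

text \<open>A spanning grown tree of an acyclic connected graph is the whole graph: an edge outside it,
  together with the path between its ends inside the grown tree, would form a cycle.\<close>

lemma finite_tree_grown:
  assumes fin: "finite (verts T)" and "is_tree T"
  shows "grown T"
proof -
  have T: "simple_graph T" "connected_graph T" "\<nexists>xs. is_cycle T xs"
    using assms by (auto simp: is_tree_def)
  obtain v where v: "v \<in> verts T" using T(2) by (auto simp: connected_graph_def)
  have "card (verts T) \<ge> 1" using v fin by (auto simp: Suc_le_eq card_gt_0_iff)
  then obtain S where S: "grown S" "subgraph S T" "card (verts S) = card (verts T)"
    using grown_extend[OF T(1,2) fin grown.single[of v], of "card (verts T)"] v
    by (auto simp: subgraph_def simple_graph_def)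
  have V: "verts S = verts T"
    using S fin by (intro card_subset_eq) (auto simp: subgraph_def)
  have "edges T \<subseteq> edges S"
  proof
    fix e assume e: "e \<in> edges T"
    show "e \<in> edges S"
    proof (rule ccontr)
      assume ne: "e \<notin> edges S"
      obtain a b where ab: "e = {a, b}" "a \<noteq> b"
        using e T(1) by (auto simp: simple_graph_def card_2_iff)
      have "a \<in> verts S" "b \<in> verts S"
        using e ab simple_graph_edge_verts[OF T(1)] V by auto
      then obtain xs where xs: "xs \<noteq> []" "hd xs = a" "last xs = b" "distinct xs"
        "successively (\<lambda>a b. {a, b} \<in> edges S) xs"
        using grown_path[OF S(1)] by blast
      \<comment> \<open>The path has an inner vertex because its ends are distinct and not adjacent in \<open>S\<close>.\<close>
      have "length xs \<noteq> 1" "length xs \<noteq> 2"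
        using xs ab ne by (auto simp: length_Suc_conv numeral_2_eq_2)
      moreover have "length xs \<noteq> 0" using xs by simp
      ultimately have l: "length xs \<ge> 3" by linarith
      have "{xs ! i, xs ! (Suc i mod length xs)} \<in> edges T" if i: "i < length xs" for i
      proof (cases "Suc i = length xs")
        case True
        then have "xs ! i = b" using xs by (metis last_conv_nth diff_Suc_1)
        moreover have "xs ! 0 = a" using xs by (simp add: hd_conv_nth)
        ultimately show ?thesis using True e ab by (simp add: insert_commute)
      next
        case False
        then have "{xs ! i, xs ! Suc i} \<in> edges S"
          using xs(5) i by (simp add: successively_conv_nth)
        then show ?thesis using False i S(2) by (auto simp: subgraph_def)
      qed
      then have "is_cycle T xs" using l xs by (simp add: is_cycle_def)
      then show False using T(3) by blast
    qed
  qed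
  then have "S = T" using V S(2) by (auto simp: subgraph_def prod_eq_iff)
  then show ?thesis using S by simp
qed

lemma grown_is_tree: "grown T \<Longrightarrow> is_tree T"
  by (simp add: is_tree_def grown_simple grown_connected grown_acyclic)

lemma Subtrees_iff:
  "t \<in> Subtrees G n \<longleftrightarrow> subgraph t G \<and> grown t \<and> card (verts t) = n"
  using finite_tree_grown[of t] grown_is_tree[of t] grown_finite_verts[of t]
  by (auto simp: Subtrees_def)

section \<open>Exchange moves and their connectivity\<close>

lemma Subtrees_edges_card:
  assumes "n > 0" "t \<in> Subtrees G n"
  shows "finite (edges t) \<and> Suc (card (edges t)) = n"
  using assms grown_card[of t] grown_finite_edges[of t] by (auto simp: Subtrees_iff)

lemma Subtrees_edges_inj:
  assumes n: "2 \<le> n" and "s \<in> Subtrees G n" "t \<in> Subtrees G n" "edges s = edges t"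
  shows "s = t"
proof -
  have "edges t \<noteq> {}"
    using Subtrees_edges_card[of n t G] assms by auto
  then have "verts s = verts t"
    using assms grown_verts_eq_Union_edges[of s] grown_verts_eq_Union_edges[of t]
    by (auto simp: Subtrees_iff)
  then show ?thesis using assms by (simp add: prod_eq_iff)
qed

lemma exchange_eqI:
  assumes "2 \<le> n" "s \<in> Subtrees G n" "edges s = edges t \<union> {e} - {e'}"
  shows "exchange G n t e e' = s"
proof -
  have "(THE r. r \<in> Subtrees G n \<and> edges r = edges t \<union> {e} - {e'}) = s"
  proof (rule the_equality)
    show "s \<in> Subtrees G n \<and> edges s = edges t \<union> {e} - {e'}"
      using assms by blast
    show "r = s" if "r \<in> Subtrees G n \<and> edges r = edges t \<union> {e} - {e'}" for r
      using that assms(3) by (intro Subtrees_edges_inj[OF assms(1) _ assms(2)]) simp_all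
  qed
  moreover have "\<exists>r\<in>Subtrees G n. edges r = edges t \<union> {e} - {e'}"
    using assms(2,3) by blast
  ultimately show ?thesis unfolding exchange_def Let_def by (simp only: if_True)
qed

lemma exchange_cases:
  assumes "2 \<le> n" "t \<in> Subtrees G n"
  shows "exchange G n t e e' = t \<or>
    exchange G n t e e' \<in> Subtrees G n \<and> edges (exchange G n t e e') = edges t \<union> {e} - {e'}"
proof (cases "\<exists>s\<in>Subtrees G n. edges s = edges t \<union> {e} - {e'}")
  case True
  then show ?thesis using exchange_eqI[OF assms(1)] by metis
next
  case False
  then show ?thesis by (auto simp: exchange_def Let_def)
qed

lemma exchange_in_Subtrees:
  assumes "2 \<le> n" "t \<in> Subtrees G n"
  shows "exchange G n t e e' \<in> Subtrees G n"
  using exchange_cases[OF assms, of e e'] assms by auto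

text \<open>Removing an edge of the tree leaves too few edges for a tree of the same size, so the exchange
  is void. This is the source of the positive holding probabilities.\<close>

lemma exchange_same_edge:
  assumes "2 \<le> n" "t \<in> Subtrees G n" "e \<in> edges t"
  shows "exchange G n t e e = t"
proof -
  have "\<not> (\<exists>s\<in>Subtrees G n. edges s = edges t \<union> {e} - {e})"
  proof
    assume "\<exists>s\<in>Subtrees G n. edges s = edges t \<union> {e} - {e}"
    then obtain s where s: "s \<in> Subtrees G n" "edges s = edges t - {e}" by auto
    have "card (edges s) = card (edges t)"
      using Subtrees_edges_card[of n s G] Subtrees_edges_card[of n t G] assms s by auto
    moreover have "card (edges s) < card (edges t)"
      using s assms Subtrees_edges_card[of n t G] by (auto intro!: card_Diff1_less)
    ultimately show False by simp
  qed
  then show ?thesis by (simp add: exchange_def)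
qed

text \<open>Since both trees have the same number of edges but differ, the added edge is new and the removed
  edge belongs to the old tree; so interchanging the two edges undoes the move.\<close>

lemma exchange_reverse:
  assumes n: "2 \<le> n" and t: "t \<in> Subtrees G n" and s: "exchange G n t e e' = s" "s \<noteq> t"
  shows "exchange G n s e' e = t"
proof -
  have sS: "s \<in> Subtrees G n" and es: "edges s = edges t \<union> {e} - {e'}"
    using exchange_cases[OF n t, of e e'] s by auto
  have ne: "edges s \<noteq> edges t"
    using Subtrees_edges_inj[OF n sS t] s by auto
  have c: "card (edges s) = card (edges t)" "finite (edges t)" "finite (edges s)"
    using Subtrees_edges_card[of n s G] Subtrees_edges_card[of n t G] n t sS by auto
  have "e \<notin> edges t"
  proof
    assume "e \<in> edges t"
    then have "edges s \<subseteq> edges t" using es by auto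
    then show False using ne c card_subset_eq by blast
  qed
  moreover have "e' \<in> edges t"
  proof (rule ccontr)
    assume "e' \<notin> edges t"
    then have "edges t \<subseteq> edges s" using es by auto
    then show False using ne c card_subset_eq by metis
  qed
  ultimately have "edges t = edges s \<union> {e'} - {e}" using es by auto
  then show ?thesis by (rule exchange_eqI[OF n t])
qed

definition exchange_rel :: "'a ugraph \<Rightarrow> nat \<Rightarrow> ('a ugraph \<times> 'a ugraph) set" where
  "exchange_rel G n = {(t, s). t \<in> Subtrees G n \<and>
     (\<exists>e\<in>edges G. \<exists>e'\<in>edges G. exchange G n t e e' = s)}"

lemma exchange_relI:
  "t \<in> Subtrees G n \<Longrightarrow> e \<in> edges G \<Longrightarrow> e' \<in> edges G \<Longrightarrow> (t, exchange G n t e e') \<in> exchange_rel G n"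
  unfolding exchange_rel_def by blast

lemma connected_graph_insert_edge:
  assumes t: "connected_graph t" and u: "u \<in> verts t"
  shows "connected_graph (insert v (verts t), insert {u, v} (edges t))" (is "connected_graph ?H")
  unfolding connected_graph_def
proof (intro conjI ballI)
  show "verts ?H \<noteq> {}" by simp
next
  fix x y assume xy: "x \<in> verts ?H" "y \<in> verts ?H"
  have "(adjacency t)\<^sup>* \<subseteq> (adjacency ?H)\<^sup>*"
    by (intro rtrancl_mono) (auto simp: adjacency_def)
  then have old: "(a, b) \<in> (adjacency ?H)\<^sup>*" if "a \<in> verts t" "b \<in> verts t" for a b
    using that t unfolding connected_graph_def by blast
  have new: "(u, v) \<in> (adjacency ?H)\<^sup>*" "(v, u) \<in> (adjacency ?H)\<^sup>*"
    by (auto simp: adjacency_def insert_commute intro!: r_into_rtrancl)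
  have "(x, u) \<in> (adjacency ?H)\<^sup>*" "(u, y) \<in> (adjacency ?H)\<^sup>*"
    using xy old u new by auto
  then show "(x, y) \<in> (adjacency ?H)\<^sup>*" by (rule rtrancl_trans)
qed

text \<open>The graph \<open>t + uv\<close> is connected with exactly \<open>n\<close> edges, so a subtree of it with \<open>n\<close> vertices
  misses exactly one edge. Growing such a subtree from \<open>C\<close> prescribes a part that the exchange must
  keep; the missed edge is not \<open>uv\<close> because \<open>uv\<close> lies in \<open>C\<close>.\<close>

lemma exchange_keeping:
  assumes n: "2 \<le> n" and G: "simple_graph G" and t: "t \<in> Subtrees G n"
    and uv: "u \<in> verts t" "{u, v} \<in> edges G" "{u, v} \<notin> edges t"
    and C: "grown C" "subgraph C (insert v (verts t), insert {u, v} (edges t))"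
      "{u, v} \<in> edges C" "card (verts C) \<le> n"
  shows "\<exists>s\<in>Subtrees G n. subgraph C s \<and> (t, s) \<in> exchange_rel G n"
proof -
  let ?H = "(insert v (verts t), insert {u, v} (edges t))"
  have tt: "subgraph t G" "grown t" "card (verts t) = n" using t n by (auto simp: Subtrees_iff)
  have ft: "finite (verts t)" by (rule grown_finite_verts[OF tt(2)])
  have subH: "subgraph ?H G"
    using tt(1) uv simple_graph_edge_verts[OF G uv(2)] by (auto simp: subgraph_def simple_graph_def)
  have "n \<le> card (verts ?H)"
    using ft tt(3) by (auto intro: card_mono)
  then obtain s where s: "grown s" "subgraph C s" "subgraph s ?H" "card (verts s) = n"
    using grown_extend[of ?H C n] C subH connected_graph_insert_edge[OF grown_connected[OF tt(2)] uv(1)] ft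
    by (auto simp: subgraph_def)
  have sS: "s \<in> Subtrees G n"
    using s n subgraph_trans[OF s(3) subH] by (simp add: Subtrees_iff)
  have fin: "finite (edges t)" "finite (edges s)" "Suc (card (edges s)) = n" "Suc (card (edges t)) = n"
    using Subtrees_edges_card[OF _ t] Subtrees_edges_card[OF _ sS] n by auto
  have sub: "edges s \<subseteq> insert {u, v} (edges t)" using s(3) by (simp add: subgraph_def)
  then have "card (insert {u, v} (edges t) - edges s) = 1"
    using fin uv(3) by (simp add: card_Diff_subset)
  then obtain e' where e': "insert {u, v} (edges t) - edges s = {e'}"
    by (auto simp: card_1_singleton_iff)
  have "{u, v} \<in> edges s" using C(3) s(2) by (auto simp: subgraph_def)
  then have "e' \<in> edges t" using e' by auto
  then have "e' \<in> edges G" using tt(1) by (auto simp: subgraph_def)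
  moreover have "edges s = insert {u, v} (edges t) - {e'}" using e' sub by (metis double_diff subset_refl)
  then have "exchange G n t {u, v} e' = s"
    by (intro exchange_eqI[OF n sS]) simp
  ultimately have "(t, s) \<in> exchange_rel G n"
    using t uv(2) exchange_relI by metis
  then show ?thesis using sS s(2) by blast
qed

text \<open>Enlarge the common subtree \<open>C\<close> by an edge of the target leaving it. If the current tree
  contains that edge, the common subtree has grown at no cost; otherwise one exchange inserts the
  edge while keeping \<open>C\<close>.\<close>

lemma exchange_reaches_from_common_subtree:
  assumes n: "2 \<le> n" and G: "simple_graph G" and s: "s \<in> Subtrees G n"
  shows "t \<in> Subtrees G n \<Longrightarrow> grown C \<Longrightarrow> subgraph C s \<Longrightarrow> subgraph C t \<Longrightarrow>
    (t, s) \<in> (exchange_rel G n)\<^sup>*"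
proof (induction "n - card (verts C)" arbitrary: t C rule: less_induct)
  case less
  have ss: "subgraph s G" "grown s" "card (verts s) = n" using s n by (auto simp: Subtrees_iff)
  have tt: "subgraph t G" "grown t" "card (verts t) = n" using less.prems n by (auto simp: Subtrees_iff)
  have le: "card (verts C) \<le> n"
    using card_mono[OF grown_finite_verts[OF ss(2)], of "verts C"] less.prems ss(3)
    by (auto simp: subgraph_def)
  show ?case
  proof (cases "card (verts C) = n")
    case True
    have "edges C = edges r" if "grown r" "card (verts r) = n" "subgraph C r" for r
    proof (rule card_subset_eq)
      show "finite (edges r)" by (rule grown_finite_edges[OF that(1)])
      show "edges C \<subseteq> edges r" using that(3) by (simp add: subgraph_def)
      show "card (edges C) = card (edges r)"
        using grown_card[OF that(1)] grown_card[OF less.prems(2)] True that(2) by simp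
    qed
    then have "edges t = edges s" using ss tt less.prems by metis
    then have "t = s" by (rule Subtrees_edges_inj[OF n less.prems(1) s])
    then show ?thesis by simp
  next
    case False
    then have "verts C \<noteq> verts s" using ss(3) by auto
    then obtain u v where uv: "u \<in> verts C" "v \<notin> verts C" "v \<in> verts s" "{u, v} \<in> edges s"
      using connected_graph_cut[OF grown_simple[OF ss(2)] grown_connected[OF ss(2)]]
        less.prems(3) grown_nonempty[OF less.prems(2)] by (metis subgraph_def)
    \<comment> \<open>The next common subtree: still part of \<open>s\<close>, with one more vertex than \<open>C\<close>.\<close>
    define D where "D = (insert v (verts C), insert {u, v} (edges C))"
    have D: "grown D" unfolding D_def using less.prems(2) uv by (intro grown.pendant) auto
    have cD: "card (verts D) = Suc (card (verts C))"
      using uv grown_finite_verts[OF less.prems(2)] by (simp add: D_def)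
    have sD: "subgraph D s"
      using grown_simple[OF D] less.prems(3) uv by (auto simp: subgraph_def D_def)
    have dec: "n - card (verts D) < n - card (verts C)" and leD: "card (verts D) \<le> n"
      using cD False le by auto
    show ?thesis
    proof (cases "{u, v} \<in> edges t")
      case True
      then have "v \<in> verts t" using simple_graph_edge_verts[OF grown_simple[OF tt(2)]] by blast
      then have "subgraph D t"
        using True grown_simple[OF D] less.prems(4) by (auto simp: subgraph_def D_def)
      then show ?thesis using less.hyps[OF dec less.prems(1) D sD] by blast
    next
      case False
      have "subgraph D (insert v (verts t), insert {u, v} (edges t))"
        using grown_simple[OF D] less.prems(4) by (auto simp: subgraph_def D_def)
      moreover have "u \<in> verts t" using uv(1) less.prems(4) by (auto simp: subgraph_def)
      moreover have "{u, v} \<in> edges G" using uv(4) ss(1) by (auto simp: subgraph_def)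
      ultimately obtain r where r: "r \<in> Subtrees G n" "subgraph D r" "(t, r) \<in> exchange_rel G n"
        using exchange_keeping[OF n G less.prems(1) _ _ False D _ _ leD] by (auto simp: D_def)
      then show ?thesis
        using less.hyps[OF dec r(1) D sD r(2)] by (meson converse_rtrancl_into_rtrancl)
    qed
  qed
qed

text \<open>For an edge \<open>yz\<close> leaving the tree, the subtree to be kept is the edge \<open>yz\<close> itself. It has only
  two vertices, so \<open>n \<ge> 2\<close> leaves room for it.\<close>

lemma exchange_reaches_vertex:
  assumes n: "2 \<le> n" and G: "simple_graph G" and t: "t \<in> Subtrees G n"
    and u: "u \<in> verts t" and uv: "(u, v) \<in> (adjacency G)\<^sup>*"
  shows "\<exists>s\<in>Subtrees G n. v \<in> verts s \<and> (t, s) \<in> (exchange_rel G n)\<^sup>*"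
  using uv
proof induction
  case base
  then show ?case using t u by blast
next
  case (step y z)
  then obtain s where s: "s \<in> Subtrees G n" "y \<in> verts s" "(t, s) \<in> (exchange_rel G n)\<^sup>*"
    by blast
  show ?case
  proof (cases "z \<in> verts s")
    case True
    then show ?thesis using s by blast
  next
    case False
    have yz: "{y, z} \<in> edges G" using step by (simp add: adjacency_def)
    have "y \<noteq> z" using False s by auto
    have nin: "{y, z} \<notin> edges s"
      using False s(1) n simple_graph_edge_verts[of s] by (auto simp: Subtrees_iff subgraph_def)
    let ?C = "(insert z {y}, insert {y, z} {})"
    have g: "grown ?C" using \<open>y \<noteq> z\<close> by (intro grown.pendant grown.single) auto
    have "\<exists>r\<in>Subtrees G n. subgraph ?C r \<and> (s, r) \<in> exchange_rel G n"
      using s(2) \<open>y \<noteq> z\<close> n grown_simple[OF g]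
      by (intro exchange_keeping[OF n G s(1) s(2) yz nin g]) (auto simp: subgraph_def)
    then show ?thesis using s(3) by (auto simp: subgraph_def intro: rtrancl_into_rtrancl)
  qed
qed

lemma exchange_rel_connected:
  assumes n: "2 \<le> n" and G: "simple_graph G" "connected_graph G"
    and t: "t \<in> Subtrees G n" and s: "s \<in> Subtrees G n"
  shows "(t, s) \<in> (exchange_rel G n)\<^sup>*"
proof -
  obtain u v where uv: "u \<in> verts t" "v \<in> verts s"
    using t s n grown_nonempty by (metis Subtrees_iff all_not_in_conv not_numeral_le_zero zero_less_iff_neq_zero)
  have "u \<in> verts G" "v \<in> verts G" using uv t s by (auto simp: Subtrees_def subgraph_def)
  then have "(u, v) \<in> (adjacency G)\<^sup>*" using G by (auto simp: connected_graph_def)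
  then obtain r where r: "r \<in> Subtrees G n" "v \<in> verts r" "(t, r) \<in> (exchange_rel G n)\<^sup>*"
    using exchange_reaches_vertex[OF n G(1) t uv(1)] by blast
  have "subgraph ({v}, {}) s" "subgraph ({v}, {}) r"
    using uv r by (auto simp: subgraph_def simple_graph_def)
  then have "(r, s) \<in> (exchange_rel G n)\<^sup>*"
    using exchange_reaches_from_common_subtree[OF n G(1) s r(1) grown.single] by blast
  with r(3) show ?thesis by (rule rtrancl_trans)
qed

section \<open>Ergodicity of finite Markov chains\<close>

lemma chain_law_add: "chain_law K \<mu> (j + k) = chain_law K (chain_law K \<mu> j) k"
  by (induction k) simp_all

lemma chain_law_bind: "chain_law K \<mu> k = bind_pmf \<mu> (\<lambda>s. chain_law K (return_pmf s) k)"
  by (induction k) (simp_all add: bind_return_pmf' bind_assoc_pmf)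

lemma set_chain_law:
  "markov_kernel_on S K \<Longrightarrow> set_pmf \<mu> \<subseteq> S \<Longrightarrow> set_pmf (chain_law K \<mu> k) \<subseteq> S"
  by (induction k) (auto simp: markov_kernel_on_def)

lemma chain_law_invariant: "invariant_on S K \<mu> \<Longrightarrow> chain_law K \<mu> k = \<mu>"
  by (induction k) (simp_all add: invariant_on_def)

lemma pmf_bind_finite:
  assumes "finite S" "set_pmf \<mu> \<subseteq> S"
  shows "pmf (bind_pmf \<mu> Q) t = (\<Sum>s\<in>S. pmf \<mu> s * pmf (Q s) t)"
  unfolding pmf_bind using assms by (subst integral_measure_pmf_real[of S]) (auto simp: mult.commute)

definition l1_dist :: "'s set \<Rightarrow> 's pmf \<Rightarrow> 's pmf \<Rightarrow> real" where
  "l1_dist S \<mu> \<nu> = (\<Sum>s\<in>S. \<bar>pmf \<mu> s - pmf \<nu> s\<bar>)"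

text \<open>Dobrushin's contraction: the difference of two probability laws has total mass zero, so a
  constant \<open>\<delta>\<close> may be subtracted from all entries of the kernel without changing its effect
  on that difference. The reduced entries are nonnegative with row sums \<open>1 - |S| \<delta>\<close>.\<close>

lemma l1_dist_contraction:
  fixes \<delta> :: real
  assumes S: "finite S" and \<mu>: "set_pmf \<mu> \<subseteq> S" and \<nu>: "set_pmf \<nu> \<subseteq> S"
    and Q: "markov_kernel_on S Q"
    and \<delta>: "\<And>s t. s \<in> S \<Longrightarrow> t \<in> S \<Longrightarrow> \<delta> \<le> pmf (Q s) t"
  shows "l1_dist S (bind_pmf \<mu> Q) (bind_pmf \<nu> Q) \<le> (1 - card S * \<delta>) * l1_dist S \<mu> \<nu>"
proof -
  define d where "d s = pmf \<mu> s - pmf \<nu> s" for s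
  have d0: "(\<Sum>s\<in>S. d s) = 0"
    using sum_pmf_eq_1[OF S \<mu>] sum_pmf_eq_1[OF S \<nu>] by (simp add: d_def sum_subtractf)
  have eq: "pmf (bind_pmf \<mu> Q) t - pmf (bind_pmf \<nu> Q) t = (\<Sum>s\<in>S. d s * (pmf (Q s) t - \<delta>))" for t
  proof -
    have "(\<Sum>s\<in>S. d s * (pmf (Q s) t - \<delta>)) = (\<Sum>s\<in>S. d s * pmf (Q s) t) - (\<Sum>s\<in>S. d s) * \<delta>"
      by (simp add: right_diff_distrib sum_subtractf sum_distrib_right)
    then show ?thesis
      using d0 by (simp add: pmf_bind_finite[OF S \<mu>] pmf_bind_finite[OF S \<nu>] d_def
          left_diff_distrib sum_subtractf)
  qed
  have "l1_dist S (bind_pmf \<mu> Q) (bind_pmf \<nu> Q) = (\<Sum>t\<in>S. \<bar>\<Sum>s\<in>S. d s * (pmf (Q s) t - \<delta>)\<bar>)"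
    by (simp add: l1_dist_def eq)
  also have "\<dots> \<le> (\<Sum>t\<in>S. \<Sum>s\<in>S. \<bar>d s\<bar> * (pmf (Q s) t - \<delta>))"
    using \<delta> by (intro sum_mono order.trans[OF sum_abs]) (auto simp: abs_mult)
  also have "\<dots> = (\<Sum>s\<in>S. \<bar>d s\<bar> * (\<Sum>t\<in>S. pmf (Q s) t - \<delta>))"
    by (subst sum.swap) (simp add: sum_distrib_left)
  also have "\<dots> = (\<Sum>s\<in>S. \<bar>d s\<bar> * (1 - card S * \<delta>))"
    using Q sum_pmf_eq_1[OF S] by (intro sum.cong) (auto simp: sum_subtractf markov_kernel_on_def)
  also have "\<dots> = (1 - card S * \<delta>) * l1_dist S \<mu> \<nu>"
    by (simp add: l1_dist_def d_def sum_distrib_left mult.commute)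
  finally show ?thesis .
qed

text \<open>The distance to the invariant law is nonincreasing (contraction with \<open>\<delta> = 0\<close> for one step), so it
  has a limit \<open>L \<ge> 0\<close>. The strict contraction over \<open>N\<close> steps passes to the limit and forces
  \<open>L = 0\<close>.\<close>

lemma chain_law_tendsto_invariant:
  assumes S: "finite S" "S \<noteq> {}" and K: "markov_kernel_on S K"
    and pos: "\<And>s t. s \<in> S \<Longrightarrow> t \<in> S \<Longrightarrow> step_prob K N s t > 0"
    and \<pi>: "invariant_on S K \<pi>" and \<mu>: "set_pmf \<mu> \<subseteq> S" and t: "t \<in> S"
  shows "(\<lambda>k. pmf (chain_law K \<mu> k) t) \<longlonglongrightarrow> pmf \<pi> t"
proof -
  define \<delta> where "\<delta> = Min ((\<lambda>(s, t). step_prob K N s t) ` (S \<times> S))"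
  have \<delta>0: "\<delta> > 0" using S pos by (auto simp: \<delta>_def)
  have \<delta>: "\<delta> \<le> step_prob K N s t" if "s \<in> S" "t \<in> S" for s t
    unfolding \<delta>_def using that S by (intro Min_le) force+
  have \<pi>S: "set_pmf \<pi> \<subseteq> S" "bind_pmf \<pi> K = \<pi>" using \<pi> by (auto simp: invariant_on_def)
  define d where "d k = l1_dist S (chain_law K \<mu> k) \<pi>" for k
  have d0: "d k \<ge> 0" for k by (simp add: d_def l1_dist_def sum_nonneg)
  have "d (Suc k) \<le> d k" for k
    using l1_dist_contraction[OF S(1) set_chain_law[OF K \<mu>, of k] \<pi>S(1) K, of 0] \<pi>S
    by (simp add: d_def)
  then have "decseq d" by (rule decseq_SucI)
  then obtain L where L: "d \<longlonglongrightarrow> L"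
    using decseq_convergent[of d 0] d0 by blast
  have "d (k + N) \<le> (1 - card S * \<delta>) * d k" for k
  proof -
    let ?Q = "\<lambda>s. chain_law K (return_pmf s) N"
    have Q: "markov_kernel_on S ?Q"
      using set_chain_law[OF K] by (simp add: markov_kernel_on_def)
    have "chain_law K \<mu> (k + N) = bind_pmf (chain_law K \<mu> k) ?Q"
      by (subst chain_law_add) (rule chain_law_bind)
    moreover have "\<pi> = bind_pmf \<pi> ?Q"
      using chain_law_bind[of K \<pi> N] chain_law_invariant[OF \<pi>] by simp
    ultimately show ?thesis
      using l1_dist_contraction[OF S(1) set_chain_law[OF K \<mu>, of k] \<pi>S(1) Q \<delta>]
      by (simp add: d_def)
  qed
  moreover have "(\<lambda>k. d (k + N)) \<longlonglongrightarrow> L" by (rule LIMSEQ_ignore_initial_segment[OF L])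
  moreover have "(\<lambda>k. (1 - card S * \<delta>) * d k) \<longlonglongrightarrow> (1 - card S * \<delta>) * L"
    by (intro tendsto_intros L)
  ultimately have "L \<le> (1 - card S * \<delta>) * L" by (intro LIMSEQ_le) auto
  then have "(card S * \<delta>) * L \<le> 0" by (simp add: algebra_simps)
  moreover have "card S * \<delta> > 0" using S \<delta>0 by (simp add: card_gt_0_iff)
  ultimately have "L \<le> 0" by (meson mult_pos_pos not_le)
  moreover have "L \<ge> 0" using L d0 by (intro LIMSEQ_le_const) auto
  ultimately have d: "d \<longlonglongrightarrow> 0" using L by simp
  have "\<bar>pmf (chain_law K \<mu> k) t - pmf \<pi> t\<bar> \<le> d k" for k
    unfolding d_def l1_dist_def
    by (rule member_le_sum[of t S "\<lambda>s. \<bar>pmf (chain_law K \<mu> k) s - pmf \<pi> s\<bar>"]) (use t S in auto)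
  then have "(\<lambda>k. pmf (chain_law K \<mu> k) t - pmf \<pi> t) \<longlonglongrightarrow> 0"
    by (intro Lim_null_comparison[OF _ d]) auto
  then show ?thesis by (simp add: LIM_zero_iff)
qed

text \<open>A symmetric stochastic matrix also has column sums one.\<close>

lemma symmetric_uniform_invariant:
  assumes S: "finite S" "S \<noteq> {}" and K: "markov_kernel_on S K" and sym: "symmetric_on S K"
  shows "invariant_on S K (pmf_of_set S)"
proof -
  have "pmf (bind_pmf (pmf_of_set S) K) t = pmf (pmf_of_set S) t" for t
  proof (cases "t \<in> S")
    case True
    have "pmf (bind_pmf (pmf_of_set S) K) t = (\<Sum>s\<in>S. pmf (K s) t / card S)"
      using S by (subst pmf_bind_finite[of S]) auto
    also have "\<dots> = (\<Sum>s\<in>S. pmf (K t) s / card S)"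
      using sym True by (intro sum.cong) (auto simp: symmetric_on_def)
    also have "\<dots> = 1 / card S"
      using K True S by (subst sum_divide_distrib[symmetric], subst sum_pmf_eq_1)
        (auto simp: markov_kernel_on_def)
    finally show ?thesis using True S by simp
  next
    case False
    then have "t \<notin> set_pmf (bind_pmf (pmf_of_set S) K)"
      using K S by (auto simp: markov_kernel_on_def)
    then have "pmf (bind_pmf (pmf_of_set S) K) t = 0" unfolding pmf_eq_0_set_pmf .
    then show ?thesis using False S by simp
  qed
  then show ?thesis using S by (simp add: invariant_on_def pmf_eqI)
qed

lemma pmf_bind_pos: "x \<in> set_pmf \<mu> \<Longrightarrow> t \<in> set_pmf (Q x) \<Longrightarrow> pmf (bind_pmf \<mu> Q) t > 0"
  by (auto simp: pmf_positive_iff)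

lemma rtrancl_step_prob:
  assumes "(s, t) \<in> {(a, b). pmf (K a) b > 0}\<^sup>*"
  shows "\<exists>k. step_prob K k s t > 0"
  using assms
proof induction
  case base
  then show ?case by (intro exI[of _ 0]) simp
next
  case (step y z)
  then obtain k where "step_prob K k s y > 0" by blast
  then have "step_prob K (Suc k) s z > 0"
    using step pmf_bind_pos[of y _ z K] by (simp add: pmf_positive_iff)
  then show ?case by blast
qed

lemma lazy_step_prob_mono:
  assumes "pmf (K t) t > 0" "step_prob K k s t > 0" "k \<le> N"
  shows "step_prob K N s t > 0"
  using assms(3)
proof (induction N rule: dec_induct)
  case base
  then show ?case by (rule assms)
next
  case (step m)
  then show ?case
    using assms(1) pmf_bind_pos[of t _ t K] by (simp add: pmf_positive_iff)
qed

lemma lazy_aperiodic: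
  assumes "\<And>s. s \<in> S \<Longrightarrow> pmf (K s) s > 0"
  shows "aperiodic_on S K"
  unfolding aperiodic_on_def
proof
  fix s assume "s \<in> S"
  then have "1 \<in> {k. k > 0 \<and> step_prob K k s s > 0}"
    using assms by (simp add: bind_return_pmf)
  then have "Gcd {k. k > 0 \<and> step_prob K k s s > 0} dvd 1" by (rule Gcd_dvd)
  then show "Gcd {k. k > 0 \<and> step_prob K k s s > 0} = (1::nat)" by simp
qed

text \<open>With positive holding probabilities a positive transition probability stays positive at all later
  times, so the largest of the finitely many required times serves all pairs of states.\<close>

lemma lazy_irreducible_positive_power:
  assumes S: "finite S" and lazy: "\<And>s. s \<in> S \<Longrightarrow> pmf (K s) s > 0" and irr: "irreducible_on S K"
  shows "\<exists>N. \<forall>s\<in>S. \<forall>t\<in>S. step_prob K N s t > 0"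
proof -
  obtain k where k: "\<And>s t. s \<in> S \<Longrightarrow> t \<in> S \<Longrightarrow> step_prob K (k s t) s t > 0"
    using irr unfolding irreducible_on_def by metis
  define N where "N = Max ((\<lambda>(s, t). k s t) ` (S \<times> S))"
  have "k s t \<le> N" if "s \<in> S" "t \<in> S" for s t
    unfolding N_def using S that by (intro Max_ge) force+
  then show ?thesis using k lazy lazy_step_prob_mono by metis
qed

text \<open>Started in an invariant law, the chain has a constant law; as it also converges to the uniform
  law, the two coincide.\<close>

lemma lazy_symmetric_ergodic:
  assumes S: "finite S" "S \<noteq> {}" and K: "markov_kernel_on S K" and sym: "symmetric_on S K"
    and lazy: "\<And>s. s \<in> S \<Longrightarrow> pmf (K s) s > 0" and irr: "irreducible_on S K"
  shows "(\<forall>\<mu>. invariant_on S K \<mu> \<longleftrightarrow> \<mu> = pmf_of_set S) \<and> law_converges_on S K (pmf_of_set S)"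
proof -
  obtain N where N: "\<And>s t. s \<in> S \<Longrightarrow> t \<in> S \<Longrightarrow> step_prob K N s t > 0"
    using lazy_irreducible_positive_power[OF S(1) lazy irr] by blast
  have inv: "invariant_on S K (pmf_of_set S)"
    by (rule symmetric_uniform_invariant[OF S K sym])
  note lim = chain_law_tendsto_invariant[OF S K N inv]
  have "\<mu> = pmf_of_set S" if \<mu>: "invariant_on S K \<mu>" for \<mu>
  proof (rule pmf_eqI)
    fix t
    have \<mu>S: "set_pmf \<mu> \<subseteq> S" using \<mu> by (simp add: invariant_on_def)
    show "pmf \<mu> t = pmf (pmf_of_set S) t"
    proof (cases "t \<in> S")
      case True
      then have "(\<lambda>k. pmf \<mu> t) \<longlonglongrightarrow> pmf (pmf_of_set S) t"
        using lim[OF _ _ \<mu>S True] by (simp add: chain_law_invariant[OF \<mu>])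
      then show ?thesis by (simp add: LIMSEQ_const_iff)
    next
      case False
      then have "t \<notin> set_pmf \<mu>" using \<mu>S by blast
      then show ?thesis using False S by (simp add: set_pmf_iff)
    qed
  qed
  moreover have "law_converges_on S K (pmf_of_set S)"
    unfolding law_converges_on_def by (intro ballI lim) auto
  ultimately show ?thesis using inv by blast
qed

section \<open>Transition probabilities of the exchange chain\<close>

lemma finite_edges:
  assumes "finite_simple_graph G"
  shows "finite (edges G)"
proof (rule finite_subset)
  show "edges G \<subseteq> Pow (verts G)"
    using assms by (auto simp: finite_simple_graph_def simple_graph_def)
  show "finite (Pow (verts G))" using assms by (simp add: finite_simple_graph_def)
qed

lemma finite_Subtrees:
  assumes "finite_simple_graph G"
  shows "finite (Subtrees G n)"
proof (rule finite_subset)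
  show "Subtrees G n \<subseteq> Pow (verts G) \<times> Pow (edges G)"
    by (auto simp: Subtrees_def subgraph_def)
  show "finite (Pow (verts G) \<times> Pow (edges G))"
    using assms finite_edges[OF assms] by (simp add: finite_simple_graph_def)
qed

lemma Subtrees_nonempty:
  assumes G: "finite_simple_graph G" "connected_graph G" and n: "1 \<le> n" "n \<le> card (verts G)"
  shows "Subtrees G n \<noteq> {}"
proof -
  obtain v where "v \<in> verts G" using G(2) by (auto simp: connected_graph_def)
  then have "subgraph ({v}, {}) G" by (simp add: subgraph_def simple_graph_def)
  then obtain T where "grown T" "subgraph T G" "card (verts T) = n"
    using grown_extend[of G "({v}, {})" n] grown.single[of v] G n
    by (auto simp: finite_simple_graph_def)
  then have "T \<in> Subtrees G n" using n by (simp add: Subtrees_iff)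
  then show ?thesis by blast
qed

lemma pmf_exchange_kernel:
  assumes "finite (edges G)" "edges G \<noteq> {}"
  shows "pmf (exchange_kernel G n t) s =
    card {p \<in> edges G \<times> edges G. exchange G n t (fst p) (snd p) = s} / (card (edges G))\<^sup>2"
proof -
  have "pair_pmf (pmf_of_set (edges G)) (pmf_of_set (edges G)) = pmf_of_set (edges G \<times> edges G)"
  proof (rule pmf_eqI)
    fix p :: "'a set \<times> 'a set"
    show "pmf (pair_pmf (pmf_of_set (edges G)) (pmf_of_set (edges G))) p =
      pmf (pmf_of_set (edges G \<times> edges G)) p"
      using assms
      by (cases p) (simp add: pmf_pair pmf_of_set indicator_def card_cartesian_product)
  qed
  then show ?thesis
    using assms
    by (simp add: exchange_kernel_def pmf_map measure_pmf_of_set card_cartesian_product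
        power2_eq_square vimage_def Int_def case_prod_unfold conj_commute)
qed

lemma set_exchange_kernel:
  assumes "finite (edges G)" "edges G \<noteq> {}"
  shows "set_pmf (exchange_kernel G n t) = {exchange G n t e e' | e e'. e \<in> edges G \<and> e' \<in> edges G}"
  using assms by (auto simp: exchange_kernel_def)

text \<open>Interchanging the two edges is a bijection between the pairs that lead from \<open>s\<close> to \<open>t\<close> and those
  that lead from \<open>t\<close> to \<open>s\<close>.\<close>

lemma exchange_kernel_symmetric:
  assumes E: "finite (edges G)" "edges G \<noteq> {}" and n: "2 \<le> n"
  shows "symmetric_on (Subtrees G n) (exchange_kernel G n)"
  unfolding symmetric_on_def
proof (intro ballI)
  fix s t assume s: "s \<in> Subtrees G n" and t: "t \<in> Subtrees G n"
  let ?A = "\<lambda>s t. {p \<in> edges G \<times> edges G. exchange G n s (fst p) (snd p) = t}"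
  show "pmf (exchange_kernel G n s) t = pmf (exchange_kernel G n t) s"
  proof (cases "s = t")
    case False
    have "bij_betw prod.swap (?A s t) (?A t s)"
      by (rule bij_betw_byWitness[where f' = prod.swap])
        (use False exchange_reverse[OF n s] exchange_reverse[OF n t] in auto)
    then have "card (?A s t) = card (?A t s)" by (rule bij_betw_same_card)
    then show ?thesis by (simp add: pmf_exchange_kernel[OF E])
  qed simp
qed

theorem mainTheorem1:
  fixes G :: "'a ugraph" and n :: nat
  assumes "finite_simple_graph G" and "connected_graph G"
    and "2 \<le> n" and "n \<le> card (verts G)"
  shows "finite (Subtrees G n) \<and> Subtrees G n \<noteq> {} \<and>
    markov_kernel_on (Subtrees G n) (exchange_kernel G n) \<and>
    aperiodic_on (Subtrees G n) (exchange_kernel G n) \<and>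
    irreducible_on (Subtrees G n) (exchange_kernel G n) \<and>
    symmetric_on (Subtrees G n) (exchange_kernel G n) \<and>
    (\<forall>\<mu>. invariant_on (Subtrees G n) (exchange_kernel G n) \<mu> \<longleftrightarrow>
          \<mu> = pmf_of_set (Subtrees G n)) \<and>
    law_converges_on (Subtrees G n) (exchange_kernel G n) (pmf_of_set (Subtrees G n))"
proof -
  let ?S = "Subtrees G n" and ?K = "exchange_kernel G n"
  note n = assms(3)
  have G: "simple_graph G" using assms(1) by (simp add: finite_simple_graph_def)
  have S: "finite ?S" "?S \<noteq> {}"
    using finite_Subtrees[OF assms(1)] Subtrees_nonempty[OF assms(1,2)] assms(3,4) by auto
  have edge: "\<exists>e. e \<in> edges t \<and> e \<in> edges G" if "t \<in> ?S" for t
  proof -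
    have "edges t \<noteq> {}" using Subtrees_edges_card[OF _ that] n by auto
    then show ?thesis using that by (auto simp: Subtrees_def subgraph_def)
  qed
  then have E: "finite (edges G)" "edges G \<noteq> {}"
    using finite_edges[OF assms(1)] S(2) by auto
  note set_K = set_exchange_kernel[OF E, of n]
  have K: "markov_kernel_on ?S ?K"
    using exchange_in_Subtrees[OF n] unfolding markov_kernel_on_def set_K by blast
  have move: "pmf (?K t) (exchange G n t e e') > 0" if "e \<in> edges G" "e' \<in> edges G" for t e e'
    using that unfolding pmf_positive_iff set_K by blast
  have lazy: "pmf (?K t) t > 0" if t: "t \<in> ?S" for t
  proof -
    obtain e where "e \<in> edges t" "e \<in> edges G" using edge[OF t] by blast
    then show ?thesis using move[of e e t] exchange_same_edge[OF n t] by simp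
  qed
  have "exchange_rel G n \<subseteq> {(a, b). pmf (?K a) b > 0}"
    unfolding exchange_rel_def using move by blast
  then have irr: "irreducible_on ?S ?K"
    unfolding irreducible_on_def
    using exchange_rel_connected[OF n G assms(2)] by (blast intro: rtrancl_step_prob dest: rtrancl_mono)
  have sym: "symmetric_on ?S ?K" by (rule exchange_kernel_symmetric[OF E n])
  show ?thesis
    by (intro conjI S K irr sym lazy_aperiodic lazy lazy_symmetric_ergodic[OF S K sym lazy irr, THEN conjunct1]
        lazy_symmetric_ergodic[OF S K sym lazy irr, THEN conjunct2])
qed

end
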